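(* Let $A$ and $B$ be independent nonnegative random variables with $\mathbb P(A>x)\sim(1+x)^{-1}$ as $x\to\infty$; $\mathbb P(B>x)=L(x)/(1+x)$ with $L$ slowly varying and $L(x)\sim(\log x)^{-1-\varepsilon}$ as $x\to\infty$ for some $\varepsilon>0$; and $b:=\mathbb E B\in(0,1)$. Then, as $x\to\infty$, $$\sum_{n\ge1}\mathbb P(A>x\,b^{-n})\ \sim\ \frac{b}{1-b}\cdot\frac1x,$$ and $$\sum_{n\ge1}\mathbb E\big[A\,\mathbf 1\{A\le x\,b^{-n}\}\big]\cdot n\,b^{\,n-1}\,\mathbb P(B>x)=o\Big(\frac1x\Big).$$
   Context: $f(x)\sim g(x)$ means $f(x)/g(x)\to1$ as $x\to\infty$. A measurable $L:(0,\infty)\to(0,\infty)$ is slowly varying if $L(tx)/L(x)\to1$ as $x\to\infty$ for each $t>0$. *)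

theory Defs
  imports "HOL-Probability.Probability" "HOL-Library.Landau_Symbols"
begin

text \<open>Only the values of \<open>L\<close> on the open half-line \<open>{0<..}\<close> are constrained.\<close>

definition slowly_varying :: "(real \<Rightarrow> real) \<Rightarrow> bool" where
  "slowly_varying L \<longleftrightarrow>
     L \<in> borel_measurable (restrict_space borel {0<..}) \<and>
     (\<forall>x>0. L x > 0) \<and>
     (\<forall>t>0. ((\<lambda>x. L (t * x) / L x) \<longlongrightarrow> 1) at_top)"

end

theory Submission
  imports Defs "HOL-Real_Asymp.Real_Asymp"
begin

text \<open>
  Since \<open>x P(A > x)\<close> tends to \<open>1\<close>, each summand of the first series is within
  a factor \<open>1 \<plusminus> \<delta>\<close> of \<open>b ^ n / x\<close> simultaneously for all \<open>n\<close>,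
  because \<open>x / b ^ n \<ge> x\<close>; the series is then compared with a geometric one. For the
  second, a bound \<open>P(A > y) \<le> K / y\<close> makes the truncated mean \<open>E[A; A \<le> y]\<close>
  grow by at most a constant whenever \<open>y\<close> is multiplied by \<open>e\<close>, hence it is
  \<open>O(1 + ln y)\<close>. The second series is therefore \<open>O(ln x P(B > x))\<close>, and the
  logarithm is beaten by \<open>L x \<sim> ln x powr (- 1 - \<epsilon>)\<close>.
\<close>

text \<open>Differentiating the geometric series twice gives coefficients
  \<open>(n + 1) * (n + 2)\<close>, which dominate \<open>(n + 1)^2\<close>. The square serves the
  second series: one factor \<open>n\<close> is its weight, the other comes from
  \<open>ln (x / b ^ n)\<close>, which is linear in \<open>n\<close>.\<close>

lemma summable_square_geometric:
  fixes b :: real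
  assumes "0 \<le> b" "b < 1"
  shows "summable (\<lambda>n. (real n)\<^sup>2 * b ^ (n - 1))"
proof -
  have 1: "summable (\<lambda>n. diffs (\<lambda>_. 1) n * x ^ n)" if "norm x < 1" for x :: real
    using that by (intro termdiff_converges[of _ 1]) auto
  have 2: "summable (\<lambda>n. diffs (diffs (\<lambda>_. 1)) n * b ^ n)"
    using assms 1 by (intro termdiff_converges[of _ 1]) auto
  have "summable (\<lambda>n. (real (Suc n))\<^sup>2 * b ^ (Suc n - 1))"
  proof (rule summable_comparison_test'[OF 2])
    fix n :: nat
    show "norm ((real (Suc n))\<^sup>2 * b ^ (Suc n - 1)) \<le> diffs (diffs (\<lambda>_. 1)) n * b ^ n"
      using assms by (auto simp: diffs_def power2_eq_square intro!: mult_mono)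
  qed
  then show ?thesis
    by (subst (asm) summable_Suc_iff)
qed

text \<open>With \<open>y = x / b ^ n\<close> one has \<open>x * G y = b ^ n * (y * G y)\<close>.
  One threshold for \<open>y * G y\<close> serves every \<open>n\<close>, so the limit passes
  through the sum and leaves \<open>c\<close> times the geometric series.\<close>

lemma sum_over_geometric_scales:
  fixes G :: "real \<Rightarrow> real" and b c :: real
  assumes b: "0 < b" "b < 1"
    and lim: "((\<lambda>y. y * G y) \<longlongrightarrow> c) at_top"
    and nonneg: "\<And>y. G y \<ge> 0"
  shows "\<forall>\<^sub>F x in at_top. (\<lambda>n. G (x / b ^ n)) summable_on {1..}"
    and "((\<lambda>x. x * (\<Sum>\<^sub>\<infinity>n\<in>{1..}. G (x / b ^ n))) \<longlongrightarrow> c * (b / (1 - b))) at_top"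
proof -
  define S where "S x = (\<Sum>\<^sub>\<infinity>n\<in>{1..}. G (x / b ^ n))" for x
  define s where "s = b / (1 - b)"
  have s: "s > 0" using b by (simp add: s_def)
  have geo: "((\<lambda>n. C * b ^ n) has_sum (C * s)) {1..}" for C
    unfolding s_def using b by (intro has_sum_cmult_right has_sum_geometric_from_1) auto
  have key: "\<forall>\<^sub>F x in at_top. (\<lambda>n. G (x / b ^ n)) summable_on {1..} \<and>
      (c - d) * s \<le> x * S x \<and>
      x * S x \<le> (c + d) * s" if d: "d > 0" for d
  proof -
    obtain X where X: "\<And>y. y \<ge> X \<Longrightarrow> \<bar>y * G y - c\<bar> < d"
      using tendstoD[OF lim d] by (auto simp: eventually_at_top_linorder dist_real_def)
    show ?thesis
      using eventually_ge_at_top[of X] eventually_gt_at_top[of 0]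
    proof eventually_elim
      case (elim x)
      have bd: "(c - d) / x * b ^ n \<le> G (x / b ^ n)" "G (x / b ^ n) \<le> (c + d) / x * b ^ n" for n
      proof -
        have "b ^ n > 0" "b ^ n \<le> 1" using b by (auto simp: power_le_one)
        then have "x / b ^ n \<ge> x" using elim by (simp add: field_simps mult_left_le)
        with X[of "x / b ^ n"] elim have "\<bar>x / b ^ n * G (x / b ^ n) - c\<bar> < d" by linarith
        then have *: "c - d \<le> x / b ^ n * G (x / b ^ n)" "x / b ^ n * G (x / b ^ n) \<le> c + d"
          by (simp_all add: abs_less_iff)
        have "(c - d) * (b ^ n / x) \<le> x / b ^ n * G (x / b ^ n) * (b ^ n / x)"
          "x / b ^ n * G (x / b ^ n) * (b ^ n / x) \<le> (c + d) * (b ^ n / x)"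
          using \<open>b ^ n > 0\<close> elim by (intro mult_right_mono[OF *(1)] mult_right_mono[OF *(2)]; simp)+
        then show "(c - d) / x * b ^ n \<le> G (x / b ^ n)" "G (x / b ^ n) \<le> (c + d) / x * b ^ n"
          using \<open>b ^ n > 0\<close> elim b by simp_all
      qed
      \<comment> \<open>Comparison with zero from below uses \<open>nonneg\<close>, since
        \<open>c - d\<close> may be negative.\<close>
      have sm: "(\<lambda>n. G (x / b ^ n)) summable_on {1..}"
        using has_sum_imp_summable[OF geo[of "(c + d) / x"]] by (rule summable_on_comparison_test) (use bd nonneg in auto)
      note hs = has_sum_infsum[OF sm, folded S_def]
      have "(c - d) / x * s \<le> S x"
        "S x \<le> (c + d) / x * s"
        by (rule has_sum_mono[OF geo hs bd(1)], rule has_sum_mono[OF hs geo bd(2)])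
      with sm elim show ?case by (auto simp: field_simps)
    qed
  qed
  show "\<forall>\<^sub>F x in at_top. (\<lambda>n. G (x / b ^ n)) summable_on {1..}"
    using key[of 1] by (auto elim: eventually_mono)
  show "((\<lambda>x. x * (\<Sum>\<^sub>\<infinity>n\<in>{1..}. G (x / b ^ n))) \<longlongrightarrow> c * (b / (1 - b))) at_top"
    unfolding s_def[symmetric] S_def[symmetric]
  proof (rule tendstoI)
    fix e :: real assume e: "e > 0"
    \<comment> \<open>With this \<open>d\<close> the sandwich has half-width
      \<open>d * s = e / 2\<close>; halving turns the weak bounds of \<open>key\<close> into the
      strict one required.\<close>
    then have "e / (2 * s) > 0" using s by simp
    from key[OF this]
    show "\<forall>\<^sub>F x in at_top. dist (x * S x) (c * s) < e"
    proof eventually_elim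
      case (elim x)
      have eqs: "(c - e / (2 * s)) * s = c * s - e / 2" "(c + e / (2 * s)) * s = c * s + e / 2"
        using s by (auto simp: field_simps)
      have "c * s - e / 2 \<le> x * S x" "x * S x \<le> c * s + e / 2"
        using elim unfolding eqs by blast+
      then show ?case using e unfolding dist_real_def abs_less_iff by linarith
    qed
  qed
qed

lemma (in finite_measure) integrable_truncation:
  fixes A :: "'a \<Rightarrow> real"
  assumes [measurable]: "A \<in> borel_measurable M" and "AE \<omega> in M. A \<omega> \<ge> 0"
  shows "integrable M (\<lambda>\<omega>. A \<omega> * indicator {\<omega>'. A \<omega>' \<le> y} \<omega>)"
proof (rule integrable_const_bound[where B = "\<bar>y\<bar>"])
  show "AE \<omega> in M. norm (A \<omega> * indicator {\<omega>'. A \<omega>' \<le> y} \<omega>) \<le> \<bar>y\<bar>"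
    using assms(2) by eventually_elim (auto simp: indicator_def)
  \<comment> \<open>The indicated set is not cut down to \<open>space M\<close>, so measurability is
    read off from the conditional form.\<close>
  have "(\<lambda>\<omega>. A \<omega> * indicator {\<omega>'. A \<omega>' \<le> y} \<omega>) = (\<lambda>\<omega>. if A \<omega> \<le> y then A \<omega> else 0)"
    by (auto simp: indicator_def)
  then show "(\<lambda>\<omega>. A \<omega> * indicator {\<omega>'. A \<omega>' \<le> y} \<omega>) \<in> borel_measurable M"
    by simp
qed

text \<open>Cut the range of \<open>A\<close> at powers of \<open>e\<close>. On the slice
  \<open>u < A \<le> e * u\<close> the variable is at most \<open>e * u\<close>, and the slice has
  probability at most \<open>K / u\<close>, so it contributes at most \<open>e * K\<close> whatever
  \<open>u\<close> is. About \<open>ln y\<close> slices cover the range from 1 to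
  \<open>y\<close>.\<close>

lemma (in prob_space) truncated_expectation_le_ln:
  fixes A :: "'a \<Rightarrow> real"
  assumes A[measurable]: "A \<in> borel_measurable M" and nonneg: "AE \<omega> in M. A \<omega> \<ge> 0"
    and tail: "\<And>y. y > 0 \<Longrightarrow> y * prob {\<omega> \<in> space M. A \<omega> > y} \<le> K"
    and y: "y \<ge> 1"
  shows "expectation (\<lambda>\<omega>. A \<omega> * indicator {\<omega>'. A \<omega>' \<le> y} \<omega>) \<le> (1 + exp 1 * K) * (1 + ln y)"
proof -
  define T where "T y = expectation (\<lambda>\<omega>. A \<omega> * indicator {\<omega>'. A \<omega>' \<le> y} \<omega>)" for y
  note int = integrable_truncation[OF A nonneg]
  have mono: "T u \<le> T v" if "u \<le> v" for u v
    unfolding T_def using nonneg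
    by (intro integral_mono_AE int, eventually_elim) (use that in \<open>auto simp: indicator_def\<close>)
  have step: "T (exp 1 * u) \<le> T u + exp 1 * K" if u: "u > 0" for u
  proof -
    let ?E = "{\<omega> \<in> space M. A \<omega> > u}"
    have E: "integrable M (\<lambda>\<omega>. exp 1 * u * indicator ?E \<omega> :: real)"
      by (intro integrable_mult_right integrable_real_indicator) (auto simp: less_top[symmetric])
    have "T (exp 1 * u) \<le> expectation (\<lambda>\<omega>. A \<omega> * indicator {\<omega>'. A \<omega>' \<le> u} \<omega> + exp 1 * u * indicator ?E \<omega>)"
      unfolding T_def
    proof (rule integral_mono_AE[OF int])
      show "integrable M (\<lambda>\<omega>. A \<omega> * indicator {\<omega>'. A \<omega>' \<le> u} \<omega> + exp 1 * u * indicator ?E \<omega>)"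
        by (rule Bochner_Integration.integrable_add[OF int E])
      show "AE \<omega> in M. A \<omega> * indicator {\<omega>'. A \<omega>' \<le> exp 1 * u} \<omega>
          \<le> A \<omega> * indicator {\<omega>'. A \<omega>' \<le> u} \<omega> + exp 1 * u * indicator ?E \<omega>"
        using nonneg AE_space by eventually_elim (use u in \<open>auto simp: indicator_def\<close>)
    qed
    also have "\<dots> = T u + exp 1 * (u * prob ?E)"
      unfolding T_def by (subst Bochner_Integration.integral_add[OF int E]) simp
    also have "\<dots> \<le> T u + exp 1 * K" using tail[OF u] by simp
    finally show ?thesis .
  qed
  have T1: "T 1 \<le> 1"
  proof -
    have "T 1 \<le> expectation (\<lambda>_. 1)"
      unfolding T_def by (intro integral_mono_AE int) (auto simp: indicator_def)
    then show ?thesis by (simp add: prob_space)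
  qed
  have pow: "T (exp (real k)) \<le> 1 + real k * (exp 1 * K)" for k
  proof (induction k)
    case (Suc k)
    then show ?case using step[of "exp (real k)"] by (simp add: exp_add algebra_simps)
  qed (use T1 in simp)
  \<comment> \<open>The number of slices: rounding up gives \<open>y \<le> exp k\<close>, and costs
    at most 1 over \<open>ln y\<close>.\<close>
  define k where "k = nat \<lceil>ln y\<rceil>"
  have ln: "ln y \<ge> 0" using y by simp
  have k: "ln y \<le> real k" "real k \<le> 1 + ln y" using ln unfolding k_def by linarith+
  have K: "exp 1 * K \<ge> 0" using tail[of 1] by (meson exp_ge_zero measure_nonneg mult_nonneg_nonneg order_trans zero_le_one zero_less_one)
  have "y \<le> exp (real k)" using k(1) y by (metis exp_le_cancel_iff exp_ln less_le_trans zero_less_one)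
  then have "T y \<le> 1 + real k * (exp 1 * K)" using mono pow order_trans by blast
  \<comment> \<open>The leading 1 is enlarged to \<open>1 + ln y\<close> so that this factor can be
    pulled out.\<close>
  also have "\<dots> \<le> (1 + ln y) + (1 + ln y) * (exp 1 * K)"
    using ln K k(2) by (intro add_mono mult_right_mono) auto
  finally show ?thesis unfolding T_def by (simp add: algebra_simps)
qed

text \<open>An infinite sum over a family that is not summable is 0 by default; pairing each
  asymptotic claim with eventual summability ensures that the sums are genuine.\<close>

theorem lemma3p6:
  fixes M :: "'a measure" and A B :: "'a \<Rightarrow> real" and L :: "real \<Rightarrow> real" and \<epsilon> b :: real
  assumes "prob_space M"
    and "prob_space.indep_var M borel A borel B"
    and "AE \<omega> in M. A \<omega> \<ge> 0"
    and "AE \<omega> in M. B \<omega> \<ge> 0"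
    and "(\<lambda>x::real. measure M {\<omega> \<in> space M. A \<omega> > x}) \<sim>[at_top] (\<lambda>x. 1 / (1 + x))"
    and "\<And>x. x > 0 \<Longrightarrow> measure M {\<omega> \<in> space M. B \<omega> > x} = L x / (1 + x)"
    and "slowly_varying L"
    and "\<epsilon> > 0"
    and "L \<sim>[at_top] (\<lambda>x. ln x powr (- 1 - \<epsilon>))"
    and "integrable M B"
    and "b = (\<integral>\<omega>. B \<omega> \<partial>M)"
    and "0 < b" and "b < 1"
  shows "(\<forall>\<^sub>F x in at_top. (\<lambda>n. measure M {\<omega> \<in> space M. A \<omega> > x / b ^ n}) summable_on {1..})
    \<and> (\<lambda>x. \<Sum>\<^sub>\<infinity>n\<in>{1..}. measure M {\<omega> \<in> space M. A \<omega> > x / b ^ n})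
         \<sim>[at_top] (\<lambda>x. b / (1 - b) * (1 / x))
    \<and> (\<forall>\<^sub>F x in at_top. (\<lambda>n. (\<integral>\<omega>. A \<omega> * indicator {\<omega>'. A \<omega>' \<le> x / b ^ n} \<omega> \<partial>M)
           * (real n * b ^ (n - 1)) * measure M {\<omega> \<in> space M. B \<omega> > x}) summable_on {1..})
    \<and> (\<lambda>x. \<Sum>\<^sub>\<infinity>n\<in>{1..}. (\<integral>\<omega>. A \<omega> * indicator {\<omega>'. A \<omega>' \<le> x / b ^ n} \<omega> \<partial>M)
           * (real n * b ^ (n - 1)) * measure M {\<omega> \<in> space M. B \<omega> > x})
         \<in> o[at_top](\<lambda>x. 1 / x)"
proof -
  interpret prob_space M by fact
  have [measurable]: "A \<in> borel_measurable M"
    using indep_var_rv1[OF assms(2)] by simp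
  define G where "G y = prob {\<omega> \<in> space M. A \<omega> > y}" for y
  define H where "H y = prob {\<omega> \<in> space M. B \<omega> > y}" for y
  define T where "T y = expectation (\<lambda>\<omega>. A \<omega> * indicator {\<omega>'. A \<omega>' \<le> y} \<omega>)" for y
  define S where "S x = (\<Sum>\<^sub>\<infinity>n\<in>{1..}. G (x / b ^ n))" for x
  define R where "R x = (\<Sum>\<^sub>\<infinity>n\<in>{1..}. T (x / b ^ n) * (real n * b ^ (n - 1)) * H x)" for x
  have b: "0 < b" "b < 1" by fact+
  have lim: "((\<lambda>y. y * G y) \<longlongrightarrow> 1) at_top"
  proof -
    have "G \<sim>[at_top] (\<lambda>x. 1 / (1 + x))" using assms(5) by (simp add: G_def[abs_def])
    also have "(\<lambda>x. 1 / (1 + x)) \<sim>[at_top] (\<lambda>x::real. 1 / x)" by real_asymp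
    finally have "(\<lambda>y. y * G y) \<sim>[at_top] (\<lambda>y. y * (1 / y))" by (intro asymp_equiv_intros)
    also have "(\<lambda>y::real. y * (1 / y)) \<sim>[at_top] (\<lambda>_. 1)" by real_asymp
    finally show ?thesis by (simp add: asymp_equivD_const)
  qed
  have G0: "G y \<ge> 0" "G y \<le> 1" for y by (auto simp: G_def)
  note scales = sum_over_geometric_scales[OF b lim G0(1)]

  have part1: "S \<sim>[at_top] (\<lambda>x. b / (1 - b) * (1 / x))"
  proof -
    have "(\<lambda>x. x * S x) \<sim>[at_top] (\<lambda>_. b / (1 - b))"
      using scales(2) b by (intro tendsto_imp_asymp_equiv_const) (auto simp: S_def)
    then have "(\<lambda>x. x * S x * (1 / x)) \<sim>[at_top] (\<lambda>x. b / (1 - b) * (1 / x))"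
      by (intro asymp_equiv_intros)
    moreover have "\<forall>\<^sub>F x in at_top. x * S x * (1 / x) = S x"
      using eventually_gt_at_top[of 0] by eventually_elim auto
    ultimately show ?thesis
      by (rule asymp_equiv_transfer) simp
  qed

  \<comment> \<open>Beyond some \<open>X\<close> the limit 1 keeps \<open>y * G y\<close> below 2;
    before \<open>X\<close>, \<open>G y \<le> 1\<close> gives
    \<open>y * G y \<le> y < X\<close>.\<close>
  obtain K where K: "\<And>y. y > 0 \<Longrightarrow> y * G y \<le> K"
  proof -
    obtain X where X: "\<And>y. y \<ge> X \<Longrightarrow> y * G y < 2"
      using order_tendstoD(2)[OF lim, of 2] by (auto simp: eventually_at_top_linorder)
    have "y * G y \<le> max 2 X" if "y > 0" for y
    proof (cases "y \<ge> X")
      case False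
      moreover have "y * G y \<le> y" using that by (intro mult_left_le G0) simp
      ultimately show ?thesis by simp
    qed (use X[of y] in simp)
    then show ?thesis using that by blast
  qed
  have K0: "K \<ge> 0" using K[of 1] G0(1)[of 1] by simp
  have T0: "T y \<ge> 0" for y
    unfolding T_def using assms(3) by (intro integral_nonneg_AE, eventually_elim) auto
  have T: "T y \<le> (1 + exp 1 * K) * (1 + ln y)" if "y \<ge> 1" for y
    unfolding T_def by (rule truncated_expectation_le_ln) (use assms(3) K that in \<open>auto simp: G_def\<close>)
  \<comment> \<open>The first factor is the constant of the truncated mean; in the second, 2 pays
    for \<open>1 + ln x\<close> and \<open>- ln b\<close> for the shift by
    \<open>b ^ n\<close>.\<close>
  define D where "D = (1 + exp 1 * K) * (2 - ln b)"
  have H0: "H y \<ge> 0" for y by (simp add: H_def)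
  \<comment> \<open>For \<open>x \<ge> exp 1\<close> and \<open>n \<ge> 1\<close>, each of 1,
    \<open>ln x\<close> and \<open>n\<close> is at most \<open>n * ln x\<close>. The bound thus
    splits into a function of \<open>x\<close> times a summable function of
    \<open>n\<close>.\<close>
  have term_le: "T (x / b ^ n) * (real n * b ^ (n - 1)) * H x \<le> D * (ln x * H x) * ((real n)\<^sup>2 * b ^ (n - 1))"
    if x: "x \<ge> exp 1" and n: "n \<ge> 1" for x n
  proof -
    have x0: "x > 0" using x exp_gt_zero[of "1 :: real"] by linarith
    have x1: "x \<ge> 1" using x one_le_exp_iff[of "1 :: real"] by linarith
    have lnx: "ln x \<ge> 1" using x x0 by (metis ln_exp ln_le_cancel_iff exp_gt_zero)
    have bn: "b ^ n > 0" "b ^ n \<le> 1" using b by (auto simp: power_le_one)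
    have "1 \<le> x / b ^ n" using bn x1 by (simp add: field_simps)
    then have "T (x / b ^ n) \<le> (1 + exp 1 * K) * (1 + ln (x / b ^ n))" by (rule T)
    also have "\<dots> \<le> (1 + exp 1 * K) * (real n * ln x * (2 - ln b))"
    proof (rule mult_left_mono)
      have "1 + ln (x / b ^ n) = 1 + ln x + real n * (- ln b)"
        using x0 b by (simp add: ln_div ln_realpow)
      also have "\<dots> \<le> real n * ln x + real n * ln x + real n * ln x * (- ln b)"
      proof (intro add_mono mult_right_mono)
        show "1 \<le> real n * ln x" using mult_mono[of 1 "real n" 1 "ln x"] lnx n by simp
        show "ln x \<le> real n * ln x" using mult_right_mono[of 1 "real n" "ln x"] lnx n by simp
        show "real n \<le> real n * ln x" using mult_left_mono[of 1 "ln x" "real n"] lnx by simp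
        show "0 \<le> - ln b" using b by simp
      qed
      finally show "1 + ln (x / b ^ n) \<le> real n * ln x * (2 - ln b)" by (simp add: algebra_simps)
    qed (use K0 in simp)
    finally have "T (x / b ^ n) \<le> D * (real n * ln x)"
      by (simp add: D_def mult_ac)
    then have "T (x / b ^ n) * (real n * b ^ (n - 1) * H x) \<le> D * (real n * ln x) * (real n * b ^ (n - 1) * H x)"
      using b H0 by (intro mult_right_mono) auto
    then show ?thesis by (simp add: power2_eq_square mult_ac)
  qed
  define W where "W = (\<Sum>\<^sub>\<infinity>n\<in>{1..}. (real n)\<^sup>2 * b ^ (n - 1))"
  have smW: "(\<lambda>n. (real n)\<^sup>2 * b ^ (n - 1)) summable_on {1..}"
    using summable_square_geometric[of b] b
    by (intro summable_on_subset[OF summable_nonneg_imp_summable_on]) auto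
  have smR: "(\<lambda>n. T (x / b ^ n) * (real n * b ^ (n - 1)) * H x) summable_on {1..}" if x: "x \<ge> exp 1" for x
    using summable_on_cmult_right[OF smW, of "D * (ln x * H x)"] by (rule summable_on_comparison_test)
      (use term_le[OF x] T0 H0 b in auto)
  have R_le: "norm (R x) \<le> D * W * norm (ln x * H x)" if x: "x \<ge> exp 1" for x
  proof -
    have "x \<ge> 1" using x one_le_exp_iff[of "1 :: real"] by linarith
    then have "ln x \<ge> 0" by simp
    have "R x \<le> (\<Sum>\<^sub>\<infinity>n\<in>{1..}. D * (ln x * H x) * ((real n)\<^sup>2 * b ^ (n - 1)))"
      unfolding R_def using smR[OF x] summable_on_cmult_right[OF smW] term_le[OF x]
      by (intro infsum_mono) auto
    also have "\<dots> = D * (ln x * H x) * W"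
      unfolding W_def using smW by (intro infsum_cmult_right)
    finally have "R x \<le> D * W * (ln x * H x)" by (simp add: mult_ac)
    moreover have "R x \<ge> 0"
      unfolding R_def using T0 H0 b by (intro infsum_nonneg) auto
    ultimately show ?thesis using \<open>ln x \<ge> 0\<close> H0[of x] by (simp add: abs_mult)
  qed
  have "R \<in> O[at_top](\<lambda>x. ln x * H x)"
    by (rule bigoI, rule eventually_mono[OF eventually_ge_at_top[of "exp 1"]], erule R_le)
  \<comment> \<open>The tail of \<open>B\<close> equals \<open>L x / (1 + x)\<close> for positive
    \<open>x\<close>, so the asymptotics of \<open>L\<close> carry over to \<open>H\<close>.\<close>
  also have "(\<lambda>x. ln x * H x) \<in> O[at_top](\<lambda>x. ln x * (ln x powr (- 1 - \<epsilon>) / (1 + x)))"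
  proof (intro landau_o.big.mult asymp_equiv_imp_bigo)
    have "(\<lambda>x. L x / (1 + x)) \<sim>[at_top] (\<lambda>x. ln x powr (- 1 - \<epsilon>) / (1 + x))"
      using assms(9) by (intro asymp_equiv_intros)
    moreover have "\<forall>\<^sub>F x in at_top. L x / (1 + x) = H x"
      using eventually_gt_at_top[of 0] by eventually_elim (simp add: H_def assms(6))
    ultimately show "H \<sim>[at_top] (\<lambda>x. ln x powr (- 1 - \<epsilon>) / (1 + x))"
      by (rule asymp_equiv_transfer) simp
  qed auto
  \<comment> \<open>The product of the logarithms is \<open>ln x powr (- \<epsilon>)\<close>, which
    tends to 0 because \<open>\<epsilon> > 0\<close>.\<close>
  also have "(\<lambda>x. ln x * (ln x powr (- 1 - \<epsilon>) / (1 + x))) \<in> o[at_top](\<lambda>x. 1 / x)"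
    using \<open>\<epsilon> > 0\<close> by real_asymp
  finally have part2: "R \<in> o[at_top](\<lambda>x. 1 / x)" .
  have "\<forall>\<^sub>F x in at_top. (\<lambda>n. T (x / b ^ n) * (real n * b ^ (n - 1)) * H x) summable_on {1..}"
    using eventually_ge_at_top[of "exp 1"] by eventually_elim (rule smR)
  with scales(1) part1 part2 show ?thesis
    unfolding S_def R_def G_def H_def T_def by blast
qed

end
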